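(* Let $n\ge 1$ and $g\in\mathbb{R}_n^+$. The following implications hold. (i) If for every $m\in\{1,\dots,n\}$ and every $f\in\mathcal{H}_m$ one has $f*g\in\mathcal{H}_m$, then $g\in Y_n$. (ii) If for every $m\in\{1,\dots,n\}$ and every $f\in\mathcal{H}_m^\star$ one has $f*g\in\mathcal{H}_m^\star$, then $g\in Y_n$. Consequently, for every $n\ge 1$, $X_n\subset Y_n$.
   Context: $\mathbb{R}_n^+$ denotes the set of real polynomials of degree $n$ all of whose coefficients (of $x^0,\dots,x^n$) are positive. $\mathcal{H}_n$ is the set of $f\in\mathbb{R}_n^+$ all of whose complex zeros $z$ satisfy $\Re(z)<0$ (stable polynomials). $\mathcal{H}_n^\star$ is the set of real polynomials $f(x)=\sum_{i=0}^n a_ix^i$ with $a_0,a_n>0$, $a_i\ge 0$ for $1\le i\le n-1$, all of whose complex zeros $z$ satisfy $\Re(z)\le 0$ (quasi-stable polynomials). The Hadamard product of $f(x)=\sum_{i=0}^n a_ix^i$ and $g(x)=\sum_{i=0}^m b_ix^i$ is $(f*g)(x)=\sum_{i=0}^{\min\{n,m\}}a_ib_ix^i$. $X_n=\{g\in\mathbb{R}_n^+ : f*g\in\mathcal{H}_m \text{ for all } 1\le m\le n \text{ and all } f\in\mathcal{H}_m\}$ (the idealizer). Basic quasi-stable polynomials: $Q^k(x)=(x^2+1)^l$ if $k=2l$, and $Q^k(x)=(x^2+1)^l+x(x^2+1)^l$ if $k=2l+1$. Their shifts: $Q_m^k(x)=x^mQ^k(x)$ for integers $m\ge 0$. $Y_n=\{g\in\mathbb{R}_n^+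 : \frac{(g*Q_m^k)(x)}{x^m}\in\mathcal{H}_k^\star \text{ for all integers } k\ge 2,\ m\ge 0 \text{ with } k+m\le n\}$. *)

theory Defs
  imports Complex_Main "HOL-Computational_Algebra.Polynomial"
begin

definition pos_polys :: "nat \<Rightarrow> real poly set" where
  "pos_polys n = {f. degree f = n \<and> (\<forall>i\<le>n. coeff f i > 0)}"

definition stable_polys :: "nat \<Rightarrow> real poly set" where
  "stable_polys n =
     {f \<in> pos_polys n. \<forall>z::complex. poly (map_poly of_real f) z = 0 \<longrightarrow> Re z < 0}"

definition quasi_stable_polys :: "nat \<Rightarrow> real poly set" where
  "quasi_stable_polys n =
     {f. degree f = n \<and> coeff f 0 > 0 \<and> coeff f n > 0 \<and> (\<forall>i\<in>{1..<n}. coeff f i \<ge> 0) \<and>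
         (\<forall>z::complex. poly (map_poly of_real f) z = 0 \<longrightarrow> Re z \<le> 0)}"

definition hadamard :: "real poly \<Rightarrow> real poly \<Rightarrow> real poly" (infixl "\<star>" 70) where
  "f \<star> g = (\<Sum>i\<le>min (degree f) (degree g). monom (coeff f i * coeff g i) i)"

definition idealizer :: "nat \<Rightarrow> real poly set" where
  "idealizer n =
     {g \<in> pos_polys n. \<forall>m\<in>{1..n}. \<forall>f\<in>stable_polys m. f \<star> g \<in> stable_polys m}"

definition basic_poly :: "nat \<Rightarrow> real poly" where
  "basic_poly k =
     (if even k then [:1, 0, 1:] ^ (k div 2)
      else [:1, 0, 1:] ^ (k div 2) + [:0, 1:] * [:1, 0, 1:] ^ (k div 2))"

definition shifted_basic_poly :: "nat \<Rightarrow> nat \<Rightarrow> real poly" where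
  "shifted_basic_poly m k = monom 1 m * basic_poly k"

(* The polynomial division below is exact, see monom_dvd_hadamard_shifted. *)
definition basic_idealizer :: "nat \<Rightarrow> real poly set" where
  "basic_idealizer n =
     {g \<in> pos_polys n. \<forall>k m. k \<ge> 2 \<longrightarrow> k + m \<le> n \<longrightarrow>
        (g \<star> shifted_basic_poly m k) div monom 1 m \<in> quasi_stable_polys k}"

lemma coeff_hadamard [simp]: "coeff (f \<star> g) i = coeff f i * coeff g i"
proof (cases "i \<le> min (degree f) (degree g)")
  case True
  then show ?thesis by (simp add: hadamard_def coeff_sum)
next
  case False
  then have "coeff f i = 0 \<or> coeff g i = 0" by (auto simp: coeff_eq_0)
  with False show ?thesis by (auto simp: hadamard_def coeff_sum)
qed

lemma monom_dvd_hadamard_shifted: "monom 1 m dvd g \<star> shifted_basic_poly m k"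
  by (simp add: monom_1_dvd_iff' shifted_basic_poly_def coeff_monom_mult)

end

theory Submission
  imports Defs "HOL-Computational_Algebra.Fundamental_Theorem_Algebra"
begin

text \<open>
  The polynomial \<open>x^m Q^k(x)\<close> is the coefficientwise limit, as \<open>e\<close> decreases to \<open>0\<close>, of the stable
  polynomials \<open>(x + e)^m (x^2 + e x + 1)^l (x + 1)^r\<close> with \<open>k = 2 l + r\<close>. Multiplication by \<open>g\<close> keeps
  the zeros of these in the closed left half-plane. For \<open>Re z > 0\<close>, a polynomial of degree
  \<open>N\<close> with leading coefficient \<open>a\<close> and all zeros in the closed left half-plane satisfies
  \<open>|p(z)| \<ge> |a| (Re z)^N\<close>; this bound passes to the limit, so the limit has no zeros in the open
  right half-plane either.
\<close>

lemma poly_map_of_real_mult: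
  fixes z :: complex
  shows "poly (map_poly of_real (p * q)) z = poly (map_poly of_real p) z * poly (map_poly of_real q) z"
proof -
  have "map_poly complex_of_real (p * q) = map_poly of_real p * map_poly of_real q"
    by (rule poly_eqI) (simp add: coeff_map_poly coeff_mult)
  then show ?thesis by simp
qed

subsection \<open>Closure of half-plane conditions under limits\<close>

text \<open>Over the complex numbers \<open>p\<close> splits into linear factors, and each factor
  \<open>z - x\<close> has real part at least \<open>Re z\<close> because
  \<open>Re x \<le> 0\<close>. The bound involves the zeros only through their number, which makes
  it uniform along a sequence of polynomials of fixed degree.\<close>

lemma norm_poly_ge_Re_power:
  fixes p :: "complex poly"
  assumes roots: "\<And>w. poly p w = 0 \<Longrightarrow> Re w \<le> 0" and z: "0 \<le> Re z"
  shows "norm (lead_coeff p) * Re z ^ degree p \<le> norm (poly p z)"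
proof (cases "p = 0")
  case False
  then obtain A where size: "size A = degree p"
    and p: "p = smult (lead_coeff p) (\<Prod>x\<in>#A. [:-x, 1:])"
    using alg_closed_imp_factorization by blast
  have eval: "poly p w = lead_coeff p * (\<Prod>x\<in>#A. w - x)" for w
    by (subst p) (simp add: poly_prod_mset)
  have "Re x \<le> 0" if "x \<in># A" for x
    using that by (intro roots) (auto simp: eval prod_mset_zero_iff)
  then have "Re z ^ size A \<le> norm (\<Prod>x\<in>#A. z - x)"
  proof (induction A)
    case (add x A)
    have "Re z \<le> Re (z - x)" using add.prems[of x] by simp
    also have "\<dots> \<le> norm (z - x)" by (rule complex_Re_le_cmod)
    finally have "Re z * Re z ^ size A \<le> norm (z - x) * norm (\<Prod>x\<in>#A. z - x)"
      using add z by (intro mult_mono) auto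
    then show ?case by (simp add: norm_mult)
  qed simp
  then show ?thesis
    by (simp add: eval norm_mult size mult_left_mono)
qed simp

text \<open>A substitute for Hurwitz's theorem. As the degree is constant in \<open>j\<close>, the
  leading coefficients of \<open>P j\<close> tend to that of \<open>p\<close>, which is nonzero, so
  the lower bound at a point with \<open>Re z > 0\<close> stays positive in the limit.\<close>

lemma Re_root_le_0_limit:
  fixes p :: "real poly" and P :: "nat \<Rightarrow> real poly"
  assumes lim: "\<And>i. (\<lambda>j. coeff (P j) i) \<longlonglongrightarrow> coeff p i"
    and deg: "\<And>j. degree (P j) = degree p"
    and roots: "\<And>j w. poly (map_poly of_real (P j)) w = (0::complex) \<Longrightarrow> Re w \<le> 0"
    and "p \<noteq> 0" and root: "poly (map_poly of_real p) z = (0::complex)"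
  shows "Re z \<le> 0"
proof (rule ccontr)
  assume "\<not> Re z \<le> 0"
  then have z: "Re z > 0" by simp
  have "norm (coeff (P j) (degree p)) * Re z ^ degree p \<le> norm (poly (map_poly of_real (P j)) z)" for j
    using norm_poly_ge_Re_power[of "map_poly of_real (P j)" z] roots z
    by (simp add: deg degree_map_poly coeff_map_poly)
  \<comment> \<open>All degrees agree, so evaluation is a sum over one fixed index range and
    converges termwise.\<close>
  moreover have "(\<lambda>j. poly (map_poly of_real (P j)) z) \<longlonglongrightarrow> poly (map_poly of_real p) z"
    by (simp add: poly_altdef deg degree_map_poly coeff_map_poly)
      (intro tendsto_intros lim)
  ultimately have "norm (coeff p (degree p)) * Re z ^ degree p \<le> norm (poly (map_poly of_real p) z)"
    by (intro LIMSEQ_le[OF tendsto_mult[OF tendsto_norm[OF lim] tendsto_const] tendsto_norm]) auto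
  with root have "\<bar>lead_coeff p\<bar> * Re z ^ degree p \<le> 0"
    by simp
  moreover have "0 < \<bar>lead_coeff p\<bar> * Re z ^ degree p"
    using z \<open>p \<noteq> 0\<close> by simp
  ultimately show False by linarith
qed

lemma tendsto_coeff_mult:
  fixes P Q :: "'b \<Rightarrow> 'a::real_normed_field poly"
  assumes "\<And>i. ((\<lambda>j. coeff (P j) i) \<longlongrightarrow> coeff p i) F"
    and "\<And>i. ((\<lambda>j. coeff (Q j) i) \<longlongrightarrow> coeff q i) F"
  shows "((\<lambda>j. coeff (P j * Q j) i) \<longlongrightarrow> coeff (p * q) i) F"
  unfolding coeff_mult by (intro tendsto_intros assms)

lemma tendsto_coeff_power:
  fixes P :: "'b \<Rightarrow> 'a::real_normed_field poly"
  assumes "\<And>i. ((\<lambda>j. coeff (P j) i) \<longlongrightarrow> coeff p i) F"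
  shows "((\<lambda>j. coeff (P j ^ n) i) \<longlongrightarrow> coeff (p ^ n) i) F"
proof (induction n arbitrary: i)
  case (Suc n)
  show ?case unfolding power_Suc by (intro tendsto_coeff_mult assms Suc.IH)
qed simp

subsection \<open>Stable approximations of the basic polynomials\<close>

lemma pos_polys_mult:
  assumes p: "p \<in> pos_polys a" and q: "q \<in> pos_polys b"
  shows "p * q \<in> pos_polys (a + b)"
proof -
  have deg: "degree p = a" "degree q = b"
    and pos: "\<And>i. i \<le> a \<Longrightarrow> coeff p i > 0" "\<And>i. i \<le> b \<Longrightarrow> coeff q i > 0"
    using p q by (auto simp: pos_polys_def)
  have nonneg: "coeff p i \<ge> 0" "coeff q i \<ge> 0" for i
    using pos[of i] deg by (cases "i \<le> a"; cases "i \<le> b"; force simp: coeff_eq_0)+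
  have "p \<noteq> 0" "q \<noteq> 0" using pos(1)[of 0] pos(2)[of 0] by auto
  then have "degree (p * q) = a + b" by (simp add: degree_mult_eq deg)
  moreover have "coeff (p * q) i > 0" if "i \<le> a + b" for i
  proof -
    \<comment> \<open>Both indices stay within the respective degrees, so this summand of the
      convolution is strictly positive, while the others are nonnegative.\<close>
    have "coeff p (min i a) * coeff q (i - min i a) > 0"
      using that by (intro mult_pos_pos pos) auto
    then show ?thesis unfolding coeff_mult
      by (intro sum_pos2[where i = "min i a"]) (auto intro: mult_nonneg_nonneg nonneg)
  qed
  ultimately show ?thesis by (simp add: pos_polys_def)
qed

lemma stable_polys_mult:
  assumes "p \<in> stable_polys a" "q \<in> stable_polys b"
  shows "p * q \<in> stable_polys (a + b)"
  using assms by (auto simp: stable_polys_def poly_map_of_real_mult intro: pos_polys_mult)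

lemma stable_polys_1: "1 \<in> stable_polys 0"
  by (simp add: stable_polys_def pos_polys_def)

lemma stable_polys_power:
  assumes "p \<in> stable_polys a"
  shows "p ^ n \<in> stable_polys (n * a)"
proof (induction n)
  case (Suc n)
  from stable_polys_mult[OF assms Suc.IH] show ?case by simp
qed (simp add: stable_polys_1)

lemma stable_polys_linear:
  assumes "c > 0"
  shows "[:c, 1:] \<in> stable_polys 1"
proof -
  have "Re z < 0" if "complex_of_real c + z = 0" for z
    using that assms by (auto simp: complex_eq_iff)
  then show ?thesis using assms
    by (auto simp: stable_polys_def pos_polys_def map_poly_pCons coeff_pCons split: nat.splits)
qed

text \<open>Since \<open>e > 0\<close>, the imaginary part of the equation forces a zero with
  \<open>Re z \<ge> 0\<close> to be real; the real part then equates a number that is at least 1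
  with 0.\<close>

lemma stable_polys_quadratic:
  assumes e: "e > 0"
  shows "[:1, e, 1:] \<in> stable_polys 2"
proof -
  have "Re z < 0" if "1 + z * (complex_of_real e + z) = 0" for z
  proof (rule ccontr)
    assume "\<not> Re z < 0"
    then have x: "Re z \<ge> 0" by simp
    from that have re: "1 + Re z * (e + Re z) = Im z * Im z"
      and im: "Im z * (e + 2 * Re z) = 0"
      by (auto simp: complex_eq_iff algebra_simps)
    from im x e have "Im z = 0" by auto
    moreover have "Re z * (e + Re z) \<ge> 0" using x e by simp
    ultimately show False using re by simp
  qed
  moreover have "coeff [:1, e, 1:] i > 0" if "i \<le> 2" for i
    using that e by (auto simp: coeff_pCons split: nat.splits)
  ultimately show ?thesis
    by (auto simp: stable_polys_def pos_polys_def map_poly_pCons)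
qed

lemma stable_polys_subset_quasi: "stable_polys n \<subseteq> quasi_stable_polys n"
  by (auto simp: stable_polys_def quasi_stable_polys_def pos_polys_def less_imp_le)

text \<open>The exponent \<open>k mod 2\<close> merges the two parity cases into one product, from
  which degree, extreme coefficients and a stable perturbation can be read off factor by
  factor.\<close>

lemma basic_poly_eq: "basic_poly k = [:1, 0, 1:] ^ (k div 2) * [:1, 1:] ^ (k mod 2)"
proof (cases "even k")
  case False
  have "[:1, 1:] = 1 + [:0, 1::real:]" by (simp add: one_pCons)
  with False show ?thesis
    by (simp add: basic_poly_def odd_iff_mod_2_eq_one algebra_simps del: pCons_one)
qed (simp add: basic_poly_def even_iff_mod_2_eq_zero)

lemma degree_basic_poly: "degree (basic_poly k) = k"
  by (simp add: basic_poly_eq degree_mult_eq degree_power_eq) presburger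

lemma lead_coeff_basic_poly: "coeff (basic_poly k) k = 1"
proof -
  have "lead_coeff (basic_poly k) = 1"
    by (simp add: basic_poly_eq lead_coeff_mult lead_coeff_power)
  then show ?thesis by (simp only: degree_basic_poly)
qed

lemma coeff_0_basic_poly: "coeff (basic_poly k) 0 = 1"
  by (simp add: basic_poly_eq coeff_mult_0 coeff_0_power)

lemma shifted_basic_poly_stable_limit:
  obtains P where "\<And>j::nat. P j \<in> stable_polys (k + m)"
    and "\<And>i. (\<lambda>j. coeff (P j) i) \<longlonglongrightarrow> coeff (shifted_basic_poly m k) i"
proof -
  define e :: "nat \<Rightarrow> real" where "e = (\<lambda>j. inverse (real (Suc j)))"
  have pos: "e j > 0" for j by (simp add: e_def)
  have e0: "e \<longlonglongrightarrow> 0" unfolding e_def by (rule LIMSEQ_inverse_real_of_nat)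
  define P where "P = (\<lambda>j. [:e j, 1:] ^ m * ([:1, e j, 1:] ^ (k div 2) * [:1, 1:] ^ (k mod 2)))"
  \<comment> \<open>The degree is written in the shape that the product and power rules produce; it
    simplifies to \<open>k + m\<close>.\<close>
  have "P j \<in> stable_polys (m * 1 + ((k div 2) * 2 + (k mod 2) * 1))" for j
    unfolding P_def
    by (intro stable_polys_mult stable_polys_power stable_polys_linear stable_polys_quadratic pos)
      simp
  then have "P j \<in> stable_polys (k + m)" for j by (simp add: add.commute)
  moreover have "(\<lambda>j. coeff (P j) i) \<longlonglongrightarrow> coeff (shifted_basic_poly m k) i" for i
  proof -
    have "(\<lambda>j. coeff [:e j, 1:] i) \<longlonglongrightarrow> coeff [:0, 1:] i" for i
      using e0 by (auto simp: coeff_pCons split: nat.splits)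
    moreover have "(\<lambda>j. coeff [:1, e j, 1:] i) \<longlonglongrightarrow> coeff [:1, 0, 1:] i" for i
      using e0 by (auto simp: coeff_pCons split: nat.splits)
    moreover have "shifted_basic_poly m k
        = [:0, 1:] ^ m * ([:1, 0, 1:] ^ (k div 2) * [:1, 1:] ^ (k mod 2))"
      by (simp add: shifted_basic_poly_def basic_poly_eq monom_altdef)
    ultimately show ?thesis
      unfolding P_def by (simp only:) (intro tendsto_coeff_mult tendsto_coeff_power tendsto_const)
  qed
  ultimately show ?thesis by (rule that)
qed

subsection \<open>The basic idealizer\<close>

text \<open>Stable input with quasi-stable output is a common consequence of the hypotheses of both
  implications, because stable polynomials are quasi-stable. One limit argument therefore serves
  both.\<close>

lemma basic_idealizerI:
  assumes g: "g \<in> pos_polys n"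
    and stable: "\<And>m f. m \<in> {1..n} \<Longrightarrow> f \<in> stable_polys m \<Longrightarrow> f \<star> g \<in> quasi_stable_polys m"
  shows "g \<in> basic_idealizer n"
proof -
  have "(g \<star> shifted_basic_poly m k) div monom 1 m \<in> quasi_stable_polys k"
    if k: "k \<ge> 2" "k + m \<le> n" for k m
  proof -
    define S where "S = shifted_basic_poly m k"
    define h where "h = (g \<star> S) div monom 1 m"
    obtain P where P: "\<And>j::nat. P j \<in> stable_polys (k + m)"
      and lim: "\<And>i. (\<lambda>j. coeff (P j) i) \<longlonglongrightarrow> coeff S i"
      unfolding S_def using shifted_basic_poly_stable_limit by metis
    have split: "g \<star> S = monom 1 m * h"
      using monom_dvd_hadamard_shifted unfolding h_def S_def by simp
    have coeff_S: "coeff S (i + m) = coeff (basic_poly k) i" for i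
      by (simp add: S_def shifted_basic_poly_def coeff_monom_mult)
    have "coeff h i = coeff (g \<star> S) (i + m)" for i
      by (simp only: split coeff_monom_mult) simp
    then have coeff_h: "coeff h i = coeff g (i + m) * coeff (basic_poly k) i" for i
      by (simp add: coeff_S)
    have g_pos: "coeff g i > 0" if "i \<le> n" for i
      using g that by (simp add: pos_polys_def)
    have h0: "coeff h 0 > 0" using k g_pos[of m] by (simp add: coeff_h coeff_0_basic_poly)
    have hk: "coeff h k > 0" using k g_pos by (simp add: coeff_h lead_coeff_basic_poly)
    have "degree h \<le> k"
      by (rule degree_le) (simp add: coeff_h coeff_eq_0 degree_basic_poly)
    with hk have deg_h: "degree h = k" by (intro antisym le_degree) auto
    from h0 have "h \<noteq> 0" by auto
    \<comment> \<open>The limit must have exactly the degree of its approximants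
      \<open>P j \<star> g\<close>, so that no zeros escape to infinity.\<close>
    then have deg: "degree (g \<star> S) = k + m"
      by (simp add: split degree_mult_eq degree_monom_eq deg_h)
    have nonneg: "coeff h i \<ge> 0" if "i < k" for i
    proof -
      \<comment> \<open>The sign of the coefficients of \<open>S\<close> is inherited from the
        positive coefficients of the approximants.\<close>
      have "coeff (P j) (i + m) \<ge> 0" for j
        using P[of j] that by (auto simp: stable_polys_def pos_polys_def less_imp_le)
      then have "coeff S (i + m) \<ge> 0"
        by (intro LIMSEQ_le_const[OF lim]) auto
      with that k g_pos[of "i + m"] show ?thesis by (simp add: coeff_h coeff_S)
    qed
    have approx: "P j \<star> g \<in> quasi_stable_polys (k + m)" for j
      using k by (intro stable P) auto
    have roots: "Re z \<le> 0" if z: "poly (map_poly of_real h) z = (0::complex)" for z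
    \<comment> \<open>The limit argument applies to \<open>g \<star> S\<close>, that is
      \<open>x^m h\<close>, among whose zeros are all those of \<open>h\<close>.\<close>
    proof (rule Re_root_le_0_limit[where P = "\<lambda>j. P j \<star> g" and p = "g \<star> S"])
      show "(\<lambda>j. coeff (P j \<star> g) i) \<longlonglongrightarrow> coeff (g \<star> S) i" for i
        by (simp add: mult.commute[of "coeff g i"]) (intro tendsto_intros lim)
      show "degree (P j \<star> g) = degree (g \<star> S)" for j
        using approx[of j] by (simp add: deg quasi_stable_polys_def)
      show "Re w \<le> 0" if "poly (map_poly of_real (P j \<star> g)) w = (0::complex)" for j w
        using approx[of j] that by (simp add: quasi_stable_polys_def)
      show "g \<star> S \<noteq> 0" using deg k by auto
      show "poly (map_poly of_real (g \<star> S)) z = 0"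
        by (simp add: split poly_map_of_real_mult z)
    qed
    have "h \<in> quasi_stable_polys k"
      using deg_h h0 hk nonneg roots by (simp add: quasi_stable_polys_def)
    then show ?thesis by (simp add: h_def S_def)
  qed
  with g show ?thesis by (simp add: basic_idealizer_def)
qed

theorem theorem6:
  fixes n :: nat
  assumes "n \<ge> 1"
  shows "(\<forall>g\<in>pos_polys n.
            (\<forall>m\<in>{1..n}. \<forall>f\<in>stable_polys m. f \<star> g \<in> stable_polys m)
            \<longrightarrow> g \<in> basic_idealizer n)
       \<and> (\<forall>g\<in>pos_polys n.
            (\<forall>m\<in>{1..n}. \<forall>f\<in>quasi_stable_polys m. f \<star> g \<in> quasi_stable_polys m)
            \<longrightarrow> g \<in> basic_idealizer n)
       \<and> idealizer n \<subseteq> basic_idealizer n"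
proof -
  have stable: "g \<in> basic_idealizer n"
    if "g \<in> pos_polys n" "\<forall>m\<in>{1..n}. \<forall>f\<in>stable_polys m. f \<star> g \<in> stable_polys m" for g
    using that stable_polys_subset_quasi by (intro basic_idealizerI) blast+
  have quasi: "g \<in> basic_idealizer n"
    if "g \<in> pos_polys n" "\<forall>m\<in>{1..n}. \<forall>f\<in>quasi_stable_polys m. f \<star> g \<in> quasi_stable_polys m" for g
    using that stable_polys_subset_quasi by (intro basic_idealizerI) blast+
  show ?thesis using stable quasi by (auto simp: idealizer_def)
qed

end
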